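(* Let $k \geq 1$ and let $(H,\Gamma)$ and $(G,\Sigma)$ be signed graphs such that $(H,\Gamma)$ is a subdivision of $(G,\Sigma)$. Then: (1) $l(G,\Sigma)=l(H,\Gamma)$; (2) $(G,\Sigma)$ is $k$-critical if and only if $(H,\Gamma)$ is $k$-critical; (3) $(G,\Sigma)$ is decomposable if and only if $(H,\Gamma)$ is decomposable.
   Context: A signed graph $(G,\Sigma)$ is a finite graph $G$ (loops and multiple edges allowed) with a set $\Sigma\subseteq E(G)$ of negative edges; other edges are positive. A circuit is negative if it has an odd number of edges in $\Sigma$; $(G,\Sigma)$ is balanced if it has no negative circuit. The frustration index $l(G,\Sigma)$ is the minimum size of $E\subseteq E(G)$ with $(G-E,\Sigma-E)$ balanced. For $k\ge1$, $(G,\Sigma)$ is $k$-critical if $l(G,\Sigma)=k$ and $l(G-e,\Sigma-\{e\})<k$ for every edge $e$. A subgraph of $(G,\Sigma)$ is $(H,\Sigma\cap E(H))$ for a subgraph $H$ of $G$. A $k$-critical signed graph is decomposable if for some $n\ge2$ and positive integers $k_1,\dots,k_n$ with sum $k$ it contains pairwise edge-disjoint subgraphs $(H_i,\Sigma_i)$ with $(H_i,\Sigma_i)$ $k_i$-critical. A $t$-multiedge $E_{xy}$ ($t\ge1$) is a set of $t$ edges between vertices $x$ and $y$; it has a sign if all its edges are positive or all are negative. Subdividing a $t$-multiedge $E_{xy}$ that has a sign: from $(G-E_{xy},\Sigma-E_{xy})$ add a new vertex $v$, $t$ positive edges between $v$ and $x$, and $t$ edges between $v$ and $y$ all having the same sign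 as $E_{xy}$. $(H,\Gamma)$ is a subdivision of $(G,\Sigma)$ if it equals $(G,\Sigma)$ or is obtained from it by a finite sequence of multiedge subdivisions. *)

theory Defs
  imports Main "HOL-Library.Uprod"
begin

text \<open>
  The values of \<open>ends\<close> outside \<open>edges\<close> carry no meaning. A loop at \<open>x\<close> is an edge with ends
  \<open>Upair x x\<close>; distinct edges may have the same ends.
\<close>

record ('v, 'e) sgraph =
  verts :: "'v set"
  edges :: "'e set"
  ends  :: "'e \<Rightarrow> 'v uprod"
  negs  :: "'e set"

definition signed_graph :: "('v, 'e) sgraph \<Rightarrow> bool" where
  "signed_graph G \<longleftrightarrow>
     finite (verts G) \<and> finite (edges G) \<and>
     (\<forall>e\<in>edges G. set_uprod (ends G e) \<subseteq> verts G) \<and> negs G \<subseteq> edges G"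

text \<open>
  Equality of signed graphs, disregarding the irrelevant values of \<open>ends\<close>.
\<close>

definition same_sgraph :: "('v, 'e) sgraph \<Rightarrow> ('v, 'e) sgraph \<Rightarrow> bool" where
  "same_sgraph G H \<longleftrightarrow>
     verts H = verts G \<and> edges H = edges G \<and>
     (\<forall>e\<in>edges G. ends H e = ends G e) \<and> negs H = negs G"

definition delete_edges :: "('v, 'e) sgraph \<Rightarrow> 'e set \<Rightarrow> ('v, 'e) sgraph" where
  "delete_edges G F = G\<lparr>edges := edges G - F, negs := negs G - F\<rparr>"

definition subgraph :: "('v, 'e) sgraph \<Rightarrow> ('v, 'e) sgraph \<Rightarrow> bool" where
  "subgraph H G \<longleftrightarrow>
     signed_graph H \<and> verts H \<subseteq> verts G \<and> edges H \<subseteq> edges G \<and>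
     (\<forall>e\<in>edges H. ends H e = ends G e) \<and> negs H = negs G \<inter> edges H"

text \<open>
  A circuit is given by its edge set. A loop is a circuit of length 1, and a pair of parallel
  edges is a circuit of length 2.
\<close>

definition circuit :: "('v, 'e) sgraph \<Rightarrow> 'e set \<Rightarrow> bool" where
  "circuit G C \<longleftrightarrow>
     (\<exists>vs es. es \<noteq> [] \<and> length vs = length es \<and> distinct vs \<and> distinct es \<and>
        set vs \<subseteq> verts G \<and> set es \<subseteq> edges G \<and>
        (\<forall>i<length es. ends G (es ! i) = Upair (vs ! i) (vs ! (Suc i mod length es))) \<and>
        C = set es)"

definition negative_circuit :: "('v, 'e) sgraph \<Rightarrow> 'e set \<Rightarrow> bool" where
  "negative_circuit G C \<longleftrightarrow> circuit G C \<and> odd (card (C \<inter> negs G))"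

definition balanced :: "('v, 'e) sgraph \<Rightarrow> bool" where
  "balanced G \<longleftrightarrow> (\<nexists>C. negative_circuit G C)"

definition frustration_index :: "('v, 'e) sgraph \<Rightarrow> nat" where
  "frustration_index G = Min {card F | F. F \<subseteq> edges G \<and> balanced (delete_edges G F)}"

definition critical :: "nat \<Rightarrow> ('v, 'e) sgraph \<Rightarrow> bool" where
  "critical k G \<longleftrightarrow>
     k \<ge> 1 \<and> frustration_index G = k \<and>
     (\<forall>e\<in>edges G. frustration_index (delete_edges G {e}) < k)"

definition decomposable :: "('v, 'e) sgraph \<Rightarrow> bool" where
  "decomposable G \<longleftrightarrow>
     (\<exists>k. critical k G \<and>
        (\<exists>(n::nat) (ks :: nat \<Rightarrow> nat) (Hs :: nat \<Rightarrow> ('v, 'e) sgraph).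
           n \<ge> 2 \<and> (\<forall>i<n. ks i \<ge> 1) \<and> (\<Sum>i<n. ks i) = k \<and>
           (\<forall>i<n. subgraph (Hs i) G \<and> critical (ks i) (Hs i)) \<and>
           (\<forall>i<n. \<forall>j<n. i \<noteq> j \<longrightarrow> edges (Hs i) \<inter> edges (Hs j) = {})))"

text \<open>
  A multiedge need not contain all edges between its two ends, and the ends may coincide.
\<close>

definition multiedge :: "('v, 'e) sgraph \<Rightarrow> 'v \<Rightarrow> 'v \<Rightarrow> 'e set \<Rightarrow> bool" where
  "multiedge G x y F \<longleftrightarrow> F \<noteq> {} \<and> F \<subseteq> edges G \<and> (\<forall>e\<in>F. ends G e = Upair x y)"

definition has_sign :: "('v, 'e) sgraph \<Rightarrow> 'e set \<Rightarrow> bool" where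
  "has_sign G F \<longleftrightarrow> F \<inter> negs G = {} \<or> F \<subseteq> negs G"

text \<open>
  \<open>A\<close> and \<open>B\<close> are the sets of new edges at the new vertex \<open>v\<close>. They are new with respect to
  the graph without \<open>F\<close>, so the names of the edges in \<open>F\<close> may be reused.
\<close>

definition multiedge_subdivision :: "('v, 'e) sgraph \<Rightarrow> ('v, 'e) sgraph \<Rightarrow> bool" where
  "multiedge_subdivision G H \<longleftrightarrow>
     (\<exists>x y F v A B.
        multiedge G x y F \<and> has_sign G F \<and>
        v \<notin> verts G \<and>
        A \<inter> (edges G - F) = {} \<and> B \<inter> (edges G - F) = {} \<and> A \<inter> B = {} \<and>
        finite A \<and> card A = card F \<and> finite B \<and> card B = card F \<and>
        verts H = insert v (verts G) \<and>
        edges H = (edges G - F) \<union> A \<union> B \<and>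
        (\<forall>e\<in>edges G - F. ends H e = ends G e) \<and>
        (\<forall>e\<in>A. ends H e = Upair v x) \<and>
        (\<forall>e\<in>B. ends H e = Upair v y) \<and>
        negs H = (negs G - F) \<union> (if F \<subseteq> negs G then B else {}))"

inductive subdivision :: "('v, 'e) sgraph \<Rightarrow> ('v, 'e) sgraph \<Rightarrow> bool"
  for G :: "('v, 'e) sgraph" where
  same: "same_sgraph G H \<Longrightarrow> subdivision G H"
| step: "subdivision G H \<Longrightarrow> multiedge_subdivision H K \<Longrightarrow> subdivision G K"

end

theory Submission
  imports Defs
begin

text \<open>
  By Harary's theorem, the frustration index is the minimum over all two-colourings of the
  vertices of the number of edges whose sign disagrees with the colouring. If the new vertex
  \<open>v\<close> carries \<open>a\<close> positive edges to \<open>x\<close> and \<open>b\<close> edges of sign \<open>\<sigma>\<close> to \<open>y\<close>, an optimal choice of the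
  colour of \<open>v\<close> contributes exactly what \<open>min a b\<close> parallel edges of sign \<open>\<sigma>\<close> between \<open>x\<close> and \<open>y\<close>
  contribute. Criticality forces \<open>a = b\<close>, so critical subgraphs of the two graphs correspond to
  each other, and disjointness is kept by distributing the edges along fixed bijections.
\<close>

section \<open>Balance and two-colourings\<close>

text \<open>The condition is symmetric in \<open>u\<close> and \<open>w\<close>, so quantifying over
  all representations of the unordered pair avoids choosing an order of the ends. A loop agrees
  exactly when it is positive.\<close>

definition agrees :: "('v, 'e) sgraph \<Rightarrow> ('v \<Rightarrow> bool) \<Rightarrow> 'e \<Rightarrow> bool" where
  "agrees G s e \<longleftrightarrow> (\<forall>u w. ends G e = Upair u w \<longrightarrow> (e \<in> negs G \<longleftrightarrow> s u \<noteq> s w))"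

lemma agrees_Upair:
  "ends G e = Upair u w \<Longrightarrow> agrees G s e \<longleftrightarrow> (e \<in> negs G \<longleftrightarrow> s u \<noteq> s w)"
  by (auto simp: agrees_def)

lemma ends_Upair: obtains u w where "ends G e = Upair u w"
  by (cases "ends G e") auto

lemma edges_delete [simp]: "edges (delete_edges G F) = edges G - F"
  and verts_delete [simp]: "verts (delete_edges G F) = verts G"
  and ends_delete [simp]: "ends (delete_edges G F) = ends G"
  and negs_delete [simp]: "negs (delete_edges G F) = negs G - F"
  by (auto simp: delete_edges_def)

lemma signed_graph_delete: "signed_graph G \<Longrightarrow> signed_graph (delete_edges G F)"
  by (auto simp: signed_graph_def)

lemma subgraph_delete: "signed_graph G \<Longrightarrow> subgraph (delete_edges G F) G"
  by (auto simp: subgraph_def signed_graph_delete) (auto simp: signed_graph_def)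

lemma agrees_delete: "e \<notin> F \<Longrightarrow> agrees (delete_edges G F) s e = agrees G s e"
  by (auto simp: agrees_def)

lemma odd_card_insert_inter:
  assumes "finite C" "e \<notin> C"
  shows "odd (card (insert e C \<inter> N)) \<longleftrightarrow> (odd (card (C \<inter> N)) \<noteq> (e \<in> N))"
  using assms by (cases "e \<in> N") auto

text \<open>Around a circuit the colour changes exactly at the negative edges, and a closed walk
  changes colour an even number of times.\<close>

lemma agrees_imp_balanced:
  assumes "\<forall>e\<in>edges G. agrees G s e"
  shows "balanced G"
proof -
  have "even (card (C \<inter> negs G))" if "circuit G C" for C
  proof -
    from that obtain vs es where c: "es \<noteq> []" "length vs = length es" "distinct es"
      "set es \<subseteq> edges G"
      "\<And>i. i < length es \<Longrightarrow> ends G (es ! i) = Upair (vs ! i) (vs ! (Suc i mod length es))"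
      "C = set es"
      unfolding circuit_def by blast
    have sgn: "es ! i \<in> negs G \<longleftrightarrow> s (vs ! i) \<noteq> s (vs ! (Suc i mod length es))"
      if "i < length es" for i
    proof -
      have "agrees G s (es ! i)" using assms c(4) nth_mem[OF that] by blast
      then show ?thesis using agrees_Upair[OF c(5)[OF that], of s] by blast
    qed
    have step: "odd (card (set (take (Suc m) es) \<inter> negs G)) \<longleftrightarrow>
        (odd (card (set (take m es) \<inter> negs G)) \<noteq> (es ! m \<in> negs G))" if "m < length es" for m
    proof -
      have "es ! m \<notin> set (take m es)"
        using c(3) that by (auto simp: in_set_conv_nth nth_eq_iff_index_eq)
      then show ?thesis
        using odd_card_insert_inter[of "set (take m es)" "es ! m"] that
        by (simp add: take_Suc_conv_app_nth)
    qed
    \<comment> \<open>The prefix stops short of the last edge, where the index wraps around to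
      \<open>0\<close>; that closing edge is added separately afterwards.\<close>
    have pref: "odd (card (set (take m es) \<inter> negs G)) \<longleftrightarrow> s (vs ! 0) \<noteq> s (vs ! m)"
      if "m < length es" for m
      using that
    proof (induction m)
      case (Suc m)
      then show ?case using step[of m] sgn[of m] by auto
    qed auto
    obtain m where m: "length es = Suc m"
      using c(1) by (cases es) auto
    have "odd (card (set (take (Suc m) es) \<inter> negs G)) \<longleftrightarrow>
      (s (vs ! 0) \<noteq> s (vs ! m)) \<noteq> (s (vs ! m) \<noteq> s (vs ! 0))"
      using step[of m] pref[of m] sgn[of m] m by simp
    then have "even (card (set (take (Suc m) es) \<inter> negs G))" by blast
    then show ?thesis using m c(6) by simp
  qed
  then show ?thesis by (auto simp: balanced_def negative_circuit_def)
qed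

section \<open>Simple paths, and colouring a balanced graph\<close>

inductive simple_path :: "('v, 'e) sgraph \<Rightarrow> 'v \<Rightarrow> 'v list \<Rightarrow> 'e list \<Rightarrow> 'v \<Rightarrow> bool"
  for G :: "('v, 'e) sgraph" and u :: 'v where
  trivial: "u \<in> verts G \<Longrightarrow> simple_path G u [u] [] u"
| snoc: "simple_path G u vs es w \<Longrightarrow> e \<in> edges G \<Longrightarrow> ends G e = Upair w z \<Longrightarrow> z \<in> verts G \<Longrightarrow>
    z \<notin> set vs \<Longrightarrow> simple_path G u (vs @ [z]) (es @ [e]) z"

text \<open>The last conjunct strengthens the induction: an appended edge has the fresh end
  \<open>z\<close>, so it cannot be among the earlier edges.\<close>

lemma simple_path_lists:
  assumes "simple_path G u vs es w"
  shows "length vs = Suc (length es) \<and> distinct vs \<and> distinct es \<and> set vs \<subseteq> verts G \<and>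
    set es \<subseteq> edges G \<and> vs ! 0 = u \<and> vs ! length es = w \<and>
    (\<forall>i<length es. ends G (es ! i) = Upair (vs ! i) (vs ! Suc i)) \<and>
    (\<forall>e\<in>set es. set_uprod (ends G e) \<subseteq> set vs)"
  using assms
proof (induction rule: simple_path.induct)
  case (snoc vs es w e z)
  then have "w \<in> set vs" by (metis lessI nth_mem)
  moreover have "e \<notin> set es" using snoc by force
  ultimately show ?case using snoc
    by (auto simp: nth_append less_Suc_eq)
qed auto

text \<open>A path can be cut at any vertex it visits. This spares a walk-to-path argument: a step
  back to a visited vertex is answered by a prefix.\<close>

lemma simple_path_prefix:
  "simple_path G u vs es w \<Longrightarrow> z \<in> set vs \<Longrightarrow> \<exists>vs' es'. simple_path G u vs' es' z"
proof (induction rule: simple_path.induct)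
  case (snoc vs es w e z')
  then show ?case using simple_path.snoc[OF snoc.hyps] by auto
qed (auto intro: simple_path.trivial)

lemma simple_path_sign:
  assumes "simple_path G u vs es w" "\<forall>e\<in>edges G. agrees G s e"
  shows "odd (card (set es \<inter> negs G)) \<longleftrightarrow> s u \<noteq> s w"
  using assms
proof (induction rule: simple_path.induct)
  case (snoc vs es w e z)
  have "e \<notin> set es"
    using simple_path_lists[OF simple_path.snoc[OF snoc.hyps]] by auto
  then have "odd (card (set (es @ [e]) \<inter> negs G)) \<longleftrightarrow>
      (odd (card (set es \<inter> negs G)) \<noteq> (e \<in> negs G))"
    using odd_card_insert_inter[of "set es" e "negs G"] by simp
  moreover have "e \<in> negs G \<longleftrightarrow> s w \<noteq> s z"
    using snoc.prems snoc.hyps(2,3) agrees_Upair by metis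
  ultimately show ?case using snoc by auto
qed auto

text \<open>The edge \<open>e\<close> leads from the last vertex back to the first, which is the
  wrap-around in \<open>circuit\<close>. If \<open>u = w\<close>, the path is trivial and
  \<open>e\<close> is a loop.\<close>

lemma simple_path_closes:
  assumes p: "simple_path (delete_edges G {e}) u vs es w"
    and e: "e \<in> edges G" "ends G e = Upair u w"
  shows "circuit G (insert e (set es))"
proof -
  note l = simple_path_lists[OF p]
  have "ends G ((es @ [e]) ! i) = Upair (vs ! i) (vs ! (Suc i mod length (es @ [e])))"
    if "i < length (es @ [e])" for i
    using that l e(2) by (cases "i = length es") (auto simp: nth_append)
  moreover have "e \<notin> set es" "set es \<subseteq> edges G" using l by auto
  ultimately show ?thesis unfolding circuit_def
    using l e(1) by (intro exI[of _ vs] exI[of _ "es @ [e]"]) auto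
qed

lemma circuit_delete: "circuit (delete_edges G F) C \<Longrightarrow> circuit G C \<and> C \<inter> F = {}"
  unfolding circuit_def by auto

lemma balanced_delete:
  assumes "balanced G" shows "balanced (delete_edges G F)"
  unfolding balanced_def negative_circuit_def
proof clarify
  fix C assume C: "circuit (delete_edges G F) C" "odd (card (C \<inter> negs (delete_edges G F)))"
  then have "C \<inter> negs (delete_edges G F) = C \<inter> negs G" using circuit_delete by fastforce
  then show False
    using C assms circuit_delete unfolding balanced_def negative_circuit_def by metis
qed

text \<open>Induction on the number of edges: colour the graph without one edge \<open>e\<close>. If
  \<open>e\<close> disagrees with the colouring, swap the colours on the component of one end of
  \<open>e\<close>; balance keeps the other end out of that component.\<close>

lemma balanced_imp_agrees:
  assumes "signed_graph G" "balanced G"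
  shows "\<exists>s. \<forall>e\<in>edges G. agrees G s e"
  using assms
proof (induction "card (edges G)" arbitrary: G)
  case 0
  then show ?case by (auto simp: signed_graph_def)
next
  case (Suc n)
  then obtain e where e: "e \<in> edges G" by (metis card.empty ex_in_conv nat.distinct(1))
  let ?D = "delete_edges G {e}"
  have "n = card (edges ?D)" using Suc.hyps(2) e Suc.prems(1) by (simp add: signed_graph_def)
  from Suc.hyps(1)[OF this signed_graph_delete[OF Suc.prems(1)] balanced_delete[OF Suc.prems(2)]]
  obtain s where s: "\<forall>f\<in>edges ?D. agrees ?D s f" by blast
  obtain u w where uw: "ends G e = Upair u w" by (rule ends_Upair)
  have V: "\<And>f a b. f \<in> edges G \<Longrightarrow> ends G f = Upair a b \<Longrightarrow> a \<in> verts G \<and> b \<in> verts G"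
    using Suc.prems(1) by (fastforce simp: signed_graph_def)
  \<comment> \<open>The component of \<open>u\<close> in the graph without \<open>e\<close>.\<close>
  define R where "R = {z. \<exists>vs es. simple_path ?D u vs es z}"
  have closed: "z \<in> R" if "a \<in> R" "f \<in> edges ?D" "ends G f = Upair a z" for a f z
  proof -
    from that(1) obtain vs es where p: "simple_path ?D u vs es a" by (auto simp: R_def)
    show ?thesis
    proof (cases "z \<in> set vs")
      case True
      then show ?thesis using simple_path_prefix[OF p] by (auto simp: R_def)
    next
      case False
      then show ?thesis
        using simple_path.snoc[OF p that(2), of z] that V[of f a z] by (auto simp: R_def)
    qed
  qed
  show ?case
  proof (cases "agrees G s e")
    case True
    then show ?thesis using s agrees_delete[of _ "{e}" G s] by (intro exI[of _ s]) auto
  next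
    case False
    then have bad: "e \<in> negs G \<longleftrightarrow> s u = s w" using agrees_Upair[OF uw, of s] by auto
    have "u \<in> R" using V[OF e uw] simple_path.trivial[of u ?D] by (auto simp: R_def)
    \<comment> \<open>A path from \<open>u\<close> to \<open>w\<close> avoiding \<open>e\<close>
      would have the parity of the colour change, so closing it with the disagreeing edge
      \<open>e\<close> would give a negative circuit.\<close>
    have "w \<notin> R"
    proof
      assume "w \<in> R"
      then obtain vs es where p: "simple_path ?D u vs es w" by (auto simp: R_def)
      have ne: "e \<notin> set es" using simple_path_lists[OF p] by auto
      have "set es \<inter> negs ?D = set es \<inter> negs G" using ne by auto
      then have "odd (card (insert e (set es) \<inter> negs G))"
        using simple_path_sign[OF p s] bad ne by (simp add: odd_card_insert_inter)
      then show False
        using simple_path_closes[OF p e uw] Suc.prems(2)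
        by (auto simp: balanced_def negative_circuit_def)
    qed
    \<comment> \<open>The inequality of truth values is exclusive or: colours are swapped exactly on
      \<open>R\<close>. This repairs \<open>e\<close>, the only edge that can leave
      \<open>R\<close>.\<close>
    define s' where "s' z = (s z \<noteq> (z \<in> R))" for z
    have "agrees G s' f" if f: "f \<in> edges G" for f
    proof (cases "f = e")
      case True
      then show ?thesis using bad \<open>u \<in> R\<close> \<open>w \<notin> R\<close> by (auto simp: agrees_Upair[OF uw] s'_def)
    next
      case False
      obtain a b where ab: "ends G f = Upair a b" by (rule ends_Upair)
      have "ends G f = Upair b a" using ab by auto
      then have "a \<in> R \<longleftrightarrow> b \<in> R" using closed f False ab by auto
      moreover have "agrees G s f" using s f False agrees_delete[of f "{e}" G s] by auto
      ultimately show ?thesis by (auto simp: agrees_Upair[OF ab] s'_def)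
    qed
    then show ?thesis by blast
  qed
qed

section \<open>The frustration index as the minimum cost of a colouring\<close>

definition cost :: "('v, 'e) sgraph \<Rightarrow> ('v \<Rightarrow> bool) \<Rightarrow> nat" where
  "cost G s = card {e \<in> edges G. \<not> agrees G s e}"

text \<open>\<open>Min\<close> is meaningful only on a finite nonempty set. Deleting all edges gives
  a member.\<close>

lemma frustration_Min:
  assumes "signed_graph G"
  shows "finite {card F | F. F \<subseteq> edges G \<and> balanced (delete_edges G F)}"
    and "{card F | F. F \<subseteq> edges G \<and> balanced (delete_edges G F)} \<noteq> {}"
proof -
  have "finite (edges G)" using assms by (simp add: signed_graph_def)
  then have "finite (card ` Pow (edges G))" by simp
  then show "finite {card F | F. F \<subseteq> edges G \<and> balanced (delete_edges G F)}"
    by (rule rev_finite_subset) auto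
  have "balanced (delete_edges G (edges G))"
    by (rule agrees_imp_balanced) auto
  then show "{card F | F. F \<subseteq> edges G \<and> balanced (delete_edges G F)} \<noteq> {}" by auto
qed

text \<open>Deleting the edges that disagree with \<open>s\<close> leaves a graph in which all edges
  agree with it.\<close>

lemma frustration_le_cost:
  assumes "signed_graph G"
  shows "frustration_index G \<le> cost G s"
proof -
  let ?F = "{e \<in> edges G. \<not> agrees G s e}"
  have "balanced (delete_edges G ?F)"
    by (rule agrees_imp_balanced[of _ s]) (auto simp: agrees_delete)
  then show ?thesis unfolding frustration_index_def cost_def
    using frustration_Min(1)[OF assms] by (intro Min_le) auto
qed

text \<open>Colour the balanced graph left by an optimal deletion set \<open>F\<close>: every edge
  that disagrees lies in \<open>F\<close>, so the cost is at most \<open>card F\<close>.\<close>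

lemma frustration_attained:
  assumes "signed_graph G"
  obtains s where "frustration_index G = cost G s"
proof -
  obtain F where F: "F \<subseteq> edges G" "balanced (delete_edges G F)" "frustration_index G = card F"
    using Min_in[OF frustration_Min[OF assms]] unfolding frustration_index_def by auto
  obtain s where s: "\<forall>e\<in>edges (delete_edges G F). agrees (delete_edges G F) s e"
    using balanced_imp_agrees[OF signed_graph_delete[OF assms] F(2)] by blast
  have "{e \<in> edges G. \<not> agrees G s e} \<subseteq> F" using s by (auto simp: agrees_delete)
  then have "cost G s \<le> card F" unfolding cost_def
    using F(1) assms by (intro card_mono) (auto simp: signed_graph_def intro: finite_subset)
  then show ?thesis using that frustration_le_cost[OF assms, of s] F(3) by force
qed

lemma frustration_mono:
  assumes "signed_graph G" "signed_graph H" "\<And>s. \<exists>s'. cost G s' \<le> cost H s"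
  shows "frustration_index G \<le> frustration_index H"
  by (metis assms frustration_attained frustration_le_cost le_trans)

section \<open>Replacing a multiedge by two multiedges at a new vertex\<close>

text \<open>This form passes to subgraphs: \<open>F\<close>, \<open>A\<close> and \<open>B\<close>
  may be empty or differ in size, and the vertex sets are not related. \<open>\<sigma>\<close> is
  true for negative edges. Edge names of \<open>F\<close> may recur in \<open>A\<close> and
  \<open>B\<close>, and \<open>x = y\<close> is allowed.\<close>

locale replacement =
  fixes G H :: "('v, 'e) sgraph" and x y v :: 'v and \<sigma> :: bool and F A B :: "'e set"
  assumes graph_G: "signed_graph G" and graph_H: "signed_graph H"
    and v_neq: "v \<noteq> x" "v \<noteq> y"
    and F_sub: "F \<subseteq> edges G" and A_sub: "A \<subseteq> edges H" and B_sub: "B \<subseteq> edges H"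
    and AB: "A \<inter> B = {}"
    and rest: "edges G - F = edges H - (A \<union> B)"
    and rest_ends: "e \<in> edges G - F \<Longrightarrow> ends H e = ends G e"
    and rest_v: "e \<in> edges G - F \<Longrightarrow> v \<notin> set_uprod (ends G e)"
    and rest_negs: "e \<in> edges G - F \<Longrightarrow> e \<in> negs H \<longleftrightarrow> e \<in> negs G"
    and F_ends: "e \<in> F \<Longrightarrow> ends G e = Upair x y" and F_negs: "e \<in> F \<Longrightarrow> e \<in> negs G \<longleftrightarrow> \<sigma>"
    and A_ends: "e \<in> A \<Longrightarrow> ends H e = Upair v x" and A_negs: "e \<in> A \<Longrightarrow> e \<notin> negs H"
    and B_ends: "e \<in> B \<Longrightarrow> ends H e = Upair v y" and B_negs: "e \<in> B \<Longrightarrow> e \<in> negs H \<longleftrightarrow> \<sigma>"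
begin

lemma finite_sets: "finite (edges G)" "finite (edges H)" "finite F" "finite A" "finite B"
  using graph_G graph_H F_sub A_sub B_sub by (auto simp: signed_graph_def intro: finite_subset)

lemma F_agrees: "e \<in> F \<Longrightarrow> agrees G s e \<longleftrightarrow> (\<sigma> \<longleftrightarrow> s x \<noteq> s y)"
  and A_agrees: "e \<in> A \<Longrightarrow> agrees H s e \<longleftrightarrow> s v = s x"
  and B_agrees: "e \<in> B \<Longrightarrow> agrees H s e \<longleftrightarrow> (\<sigma> \<longleftrightarrow> s v \<noteq> s y)"
  using agrees_Upair[OF F_ends, of e s] F_negs agrees_Upair[OF A_ends, of e s] A_negs
    agrees_Upair[OF B_ends, of e s] B_negs
  by blast+

definition rest_cost :: "('v \<Rightarrow> bool) \<Rightarrow> nat" where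
  "rest_cost s = card {e \<in> edges G - F. \<not> agrees G s e}"

lemma rest_cost_upd: "rest_cost (s(v := c)) = rest_cost s"
proof -
  have "agrees G (s(v := c)) e = agrees G s e" if "e \<in> edges G - F" for e
  proof -
    obtain a b where ab: "ends G e = Upair a b" by (rule ends_Upair)
    then show ?thesis using rest_v[OF that] by (auto simp: agrees_Upair[OF ab])
  qed
  then show ?thesis unfolding rest_cost_def by (metis (mono_tags, lifting))
qed

text \<open>The edges of \<open>F\<close> share ends and sign, so they agree with a colouring all
  together or not at all.\<close>

lemma cost_G: "cost G s = rest_cost s + (if \<sigma> \<longleftrightarrow> s x \<noteq> s y then 0 else card F)"
proof -
  have "{e \<in> edges G. \<not> agrees G s e} =
    {e \<in> edges G - F. \<not> agrees G s e} \<union> (if \<sigma> \<longleftrightarrow> s x \<noteq> s y then {} else F)"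
    using F_sub by (auto simp: F_agrees)
  also have "card \<dots> = card {e \<in> edges G - F. \<not> agrees G s e} +
      card (if \<sigma> \<longleftrightarrow> s x \<noteq> s y then {} else F)"
    using finite_sets by (intro card_Un_disjoint) auto
  finally show ?thesis unfolding cost_def rest_cost_def by (simp split del: if_split) auto
qed

lemma cost_H:
  "cost H s = rest_cost s + (if s v \<noteq> s x then card A else 0) +
    (if \<sigma> \<longleftrightarrow> s v \<noteq> s y then 0 else card B)"
proof -
  have *: "agrees H s e = agrees G s e" if "e \<in> edges G - F" for e
    using rest_ends[OF that] rest_negs[OF that] by (simp add: agrees_def)
  let ?R = "{e \<in> edges G - F. \<not> agrees G s e}"
  let ?A = "if s v \<noteq> s x then A else {}" and ?B = "if \<sigma> \<longleftrightarrow> s v \<noteq> s y then {} else B"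
  have "{e \<in> edges H. \<not> agrees H s e} = {e \<in> edges H - (A \<union> B). \<not> agrees H s e} \<union> ?A \<union> ?B"
    using A_sub B_sub by (auto simp: A_agrees B_agrees)
  also have "{e \<in> edges H - (A \<union> B). \<not> agrees H s e} = ?R"
    unfolding rest[symmetric] using * by blast
  finally have "cost H s = card (?R \<union> ?A \<union> ?B)" unfolding cost_def by simp
  also have "\<dots> = card (?R \<union> ?A) + card ?B"
    using finite_sets AB rest by (intro card_Un_disjoint) auto
  also have "card (?R \<union> ?A) = card ?R + card ?A"
    using finite_sets rest by (intro card_Un_disjoint) auto
  finally show ?thesis unfolding rest_cost_def by auto
qed

text \<open>If \<open>F\<close> agrees with a colouring, giving \<open>v\<close> the colour of
  \<open>x\<close> makes \<open>A\<close> and \<open>B\<close> agree. If \<open>F\<close> disagrees,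
  exactly one of \<open>A\<close> and \<open>B\<close> disagrees, and the colour of \<open>v\<close>
  decides which.\<close>

lemma frustration_eq:
  assumes "card F = min (card A) (card B)"
  shows "frustration_index G = frustration_index H"
proof (rule antisym)
  have "cost G s \<le> cost H s" for s
    unfolding cost_G cost_H assms by auto
  then show "frustration_index G \<le> frustration_index H"
    using frustration_mono[OF graph_G graph_H] by blast
  have "\<exists>s'. cost H s' \<le> cost G s" for s
  proof -
    \<comment> \<open>Copying the colour of \<open>x\<close> charges \<open>B\<close> if
      \<open>F\<close> disagrees; the opposite colour charges \<open>A\<close>. The smaller side is
      charged.\<close>
    define c where "c = (if (\<sigma> \<longleftrightarrow> s x \<noteq> s y) \<or> card B < card A then s x else \<not> s x)"
    have "cost H (s(v := c)) \<le> cost G s"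
      unfolding cost_G cost_H rest_cost_upd assms using v_neq by (auto simp: c_def)
    then show ?thesis by blast
  qed
  then show "frustration_index H \<le> frustration_index G"
    using frustration_mono[OF graph_H graph_G] by blast
qed

text \<open>The two subgraphs need only match outside the replaced edges; how many edges they keep
  from \<open>F\<close>, \<open>A\<close> and \<open>B\<close> is free.\<close>

lemma restrict:
  assumes G': "subgraph G' G" and H': "subgraph H' H"
    and r: "edges G' - F = edges H' - (A \<union> B)"
  shows "replacement G' H' x y v \<sigma> (F \<inter> edges G') (A \<inter> edges H') (B \<inter> edges H')"
proof
  have [simp]: "negs G' = negs G \<inter> edges G'" "negs H' = negs H \<inter> edges H'"
    using G' H' by (simp_all add: subgraph_def)
  have E: "ends G' e = ends G e" "e \<in> edges G" if "e \<in> edges G'" for e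
    using that G' by (auto simp: subgraph_def)
  have E': "ends H' e = ends H e" if "e \<in> edges H'" for e
    using that H' by (auto simp: subgraph_def)
  show "edges G' - F \<inter> edges G' = edges H' - (A \<inter> edges H' \<union> B \<inter> edges H')"
    using r by blast
  fix e
  {
    assume "e \<in> edges G' - F \<inter> edges G'"
    then have "e \<in> edges G' - F" "e \<in> edges H'" "e \<in> edges G - F" using r E by auto
    then show "ends H' e = ends G' e" "v \<notin> set_uprod (ends G' e)" "e \<in> negs H' \<longleftrightarrow> e \<in> negs G'"
      using E E' rest_ends rest_v rest_negs by auto
  }
qed (use G' H' v_neq AB F_ends F_negs A_ends A_negs B_ends B_negs in \<open>auto simp: subgraph_def\<close>)

lemma restrict_delete:
  assumes "(edges G - P) - F = (edges H - Q) - (A \<union> B)"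
  shows "replacement (delete_edges G P) (delete_edges H Q) x y v \<sigma> (F - P) (A - Q) (B - Q)"
proof -
  have "F \<inter> (edges G - P) = F - P" "A \<inter> (edges H - Q) = A - Q" "B \<inter> (edges H - Q) = B - Q"
    using F_sub A_sub B_sub by auto
  then show ?thesis
    using restrict[OF subgraph_delete[OF graph_G] subgraph_delete[OF graph_H], of P Q] assms by simp
qed

text \<open>
  If there are more edges on one side of \<open>v\<close> than on the other, deleting one of the majority
  leaves \<open>min (card A) (card B)\<close> unchanged.
\<close>

lemma critical_imp_card_eq:
  assumes F: "card F = min (card A) (card B)" and crit: "critical k H"
  shows "card A = card B"
proof (rule ccontr)
  assume ne: "card A \<noteq> card B"
  define M where "M = (if card B < card A then A else B)"
  have "finite M" "card M \<noteq> 0" using ne finite_sets by (auto simp: M_def)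
  then obtain e where e: "e \<in> M" by fastforce
  then have eH: "e \<in> edges H" and eAB: "e \<in> A \<union> B" using A_sub B_sub by (auto simp: M_def split: if_splits)
  \<comment> \<open>Deleting nothing on one side compares the same \<open>G\<close> with both
    \<open>H\<close> and \<open>H\<close> without \<open>e\<close>, so these two have equal
    frustration index.\<close>
  have "replacement (delete_edges G {}) (delete_edges H {e}) x y v \<sigma> (F - {}) (A - {e}) (B - {e})"
    using eAB rest by (intro restrict_delete) auto
  moreover have "delete_edges G {} = G" by (simp add: delete_edges_def)
  ultimately interpret d: replacement G "delete_edges H {e}" x y v \<sigma> F "A - {e}" "B - {e}"
    by simp
  have "card F = min (card (A - {e})) (card (B - {e}))"
  proof (cases "card B < card A")
    case True
    then have "e \<in> A" "e \<notin> B" using e AB by (auto simp: M_def)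
    then show ?thesis using F True by simp
  next
    case False
    then have "e \<in> B" "e \<notin> A" using e AB by (auto simp: M_def)
    then show ?thesis using F False ne by simp
  qed
  then have "frustration_index (delete_edges H {e}) = frustration_index H"
    using d.frustration_eq frustration_eq[OF F] by simp
  then show False using crit eH by (auto simp: critical_def)
qed

text \<open>Deletions outside the replaced edges correspond directly. Deleting any edge of
  \<open>F\<close> matches deleting any edge of \<open>A\<close> or \<open>B\<close>, since either
  way the minimum of the two sides drops by one.\<close>

lemma critical_iff:
  assumes "card A = card F" "card B = card F"
  shows "critical k G \<longleftrightarrow> critical k H"
proof -
  have eq: "frustration_index G = frustration_index H"
    using assms by (intro frustration_eq) simp
  have R: "frustration_index (delete_edges G {e}) = frustration_index (delete_edges H {e})"
    if "e \<in> edges G - F" for e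
  proof -
    have "e \<notin> F" "e \<notin> A" "e \<notin> B" using that rest by auto
    then have "replacement (delete_edges G {e}) (delete_edges H {e}) x y v \<sigma> F A B"
      using restrict_delete[of "{e}" "{e}"] rest by auto
    from replacement.frustration_eq[OF this] assms show ?thesis by simp
  qed
  have N: "frustration_index (delete_edges G {e}) = frustration_index (delete_edges H {e'})"
    if "e \<in> F" "e' \<in> A \<union> B" for e e'
  proof -
    have "replacement (delete_edges G {e}) (delete_edges H {e'}) x y v \<sigma> (F - {e}) (A - {e'}) (B - {e'})"
      using that rest by (intro restrict_delete) auto
    moreover have "card (F - {e}) = min (card (A - {e'})) (card (B - {e'}))"
    proof (cases "e' \<in> A")
      case True
      then have "e' \<notin> B" using AB by auto
      then show ?thesis using True that(1) assms by simp
    next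
      case False
      then show ?thesis using that assms by simp
    qed
    ultimately show ?thesis by (rule replacement.frustration_eq)
  qed
  \<comment> \<open>\<open>N\<close> compares arbitrary pairs, so the two universal statements are
    equivalent once both sets are nonempty or both are empty.\<close>
  have "F = {} \<longleftrightarrow> A \<union> B = {}"
    using assms finite_sets by (metis Un_empty card_0_eq)
  then have "(\<forall>e\<in>F. frustration_index (delete_edges G {e}) < k) \<longleftrightarrow>
      (\<forall>e\<in>A \<union> B. frustration_index (delete_edges H {e}) < k)"
    using N by (metis ex_in_conv)
  moreover have "(\<forall>e\<in>edges G - F. frustration_index (delete_edges G {e}) < k) \<longleftrightarrow>
      (\<forall>e\<in>edges H - (A \<union> B). frustration_index (delete_edges H {e}) < k)"
    using R rest by simp
  moreover have "Ball (edges G) p \<longleftrightarrow> Ball (edges G - F) p \<and> Ball F p"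
    "Ball (edges H) p \<longleftrightarrow> Ball (edges H - (A \<union> B)) p \<and> Ball (A \<union> B) p" for p
    using F_sub A_sub B_sub by blast+
  ultimately have "(\<forall>e\<in>edges G. frustration_index (delete_edges G {e}) < k) \<longleftrightarrow>
      (\<forall>e\<in>edges H. frustration_index (delete_edges H {e}) < k)"
    by simp
  then show ?thesis unfolding critical_def eq by blast
qed

end

section \<open>Transferring decompositions\<close>

lemma decomposableI:
  assumes "critical k G" "n \<ge> (2::nat)" "\<forall>i<n. ks i \<ge> 1" "(\<Sum>i<n. ks i) = k"
    "\<forall>i<n. subgraph (Hs i) G \<and> critical (ks i) (Hs i)"
    "\<forall>i<n. \<forall>j<n. i \<noteq> j \<longrightarrow> edges (Hs i) \<inter> edges (Hs j) = {}"
  shows "decomposable G"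
  unfolding decomposable_def
  by (rule exI[of _ k], rule conjI[OF assms(1)], rule exI[of _ n], rule exI[of _ ks],
      rule exI[of _ Hs]) (intro conjI assms)

lemma decomposableE:
  assumes "decomposable G"
  obtains k n ks Hs where "critical k G" "n \<ge> (2::nat)" "\<forall>i<n. ks i \<ge> 1" "(\<Sum>i<n. ks i) = k"
    "\<forall>i<n. subgraph (Hs i) G \<and> critical (ks i) (Hs i)"
    "\<forall>i<n. \<forall>j<n. i \<noteq> j \<longrightarrow> edges (Hs i) \<inter> edges (Hs j) = {}"
  using assms unfolding decomposable_def by (elim exE conjE) (rule that; assumption)

lemma disjoint_images:
  assumes "inj_on f X" "P \<subseteq> X" "Q \<subseteq> X" "P \<inter> Q = {}"
  shows "f ` P \<inter> f ` Q = {}"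
  using assms by (metis image_empty inj_on_image_Int)

text \<open>A transferred subgraph consists of unreplaced edges and of layers inside two disjoint
  sets, so disjointness can be checked layer by layer.\<close>

lemma disjoint_layers:
  assumes "P \<inter> P' = {}" "Q \<inter> Q' = {}" "R \<inter> R' = {}" "Q \<union> Q' \<subseteq> A" "R \<union> R' \<subseteq> B" "A \<inter> B = {}"
    "(P \<union> P') \<inter> (A \<union> B) = {}"
  shows "(P \<union> Q \<union> R) \<inter> (P' \<union> Q' \<union> R') = {}"
  using assms by blast

text \<open>The situation of the whole graphs; \<open>replacement\<close> alone serves for their
  subgraphs.\<close>

locale full_replacement = replacement +
  assumes card_A: "card A = card F" and card_B: "card B = card F"
    and verts_H: "verts H = insert v (verts G)"
begin

text \<open>The map \<open>f\<close> is fixed independently of \<open>H'\<close>, so disjoint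
  subgraphs of \<open>H\<close> receive disjoint edges of \<open>F\<close>.\<close>

lemma critical_subgraph_to_G:
  assumes bij: "bij_betw f A F" and sub: "subgraph H' H" and crit: "critical k H'"
  shows "\<exists>G'. subgraph G' G \<and> critical k G' \<and>
    edges G' \<subseteq> (edges H' - (A \<union> B)) \<union> f ` (A \<inter> edges H')"
proof -
  let ?A = "A \<inter> edges H'" and ?B = "B \<inter> edges H'"
  \<comment> \<open>Equality of the two sides is not known yet. The minimum makes
    \<open>frustration_eq\<close> apply, and criticality of \<open>H'\<close> then yields
    equality.\<close>
  obtain A' where A': "A' \<subseteq> ?A" "card A' = min (card ?A) (card ?B)"
    by (meson min.cobounded1 obtain_subset_with_card_n)
  define F' where "F' = f ` A'"
  have F'F: "F' \<subseteq> F" using bij A' by (auto simp: F'_def bij_betw_def)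
  have "inj_on f A'" using bij A' by (auto simp: bij_betw_def intro: inj_on_subset)
  then have cF': "card F' = min (card ?A) (card ?B)" using A' by (simp add: F'_def card_image)
  define E where "E = (edges H' - (A \<union> B)) \<union> F'"
  define G' where "G' = G\<lparr>verts := verts H' - {v}, edges := E, negs := negs G \<inter> E\<rparr>"
  have H'sub: "verts H' \<subseteq> verts H" "edges H' \<subseteq> edges H" and H': "signed_graph H'"
    and H'ends: "\<And>e. e \<in> edges H' \<Longrightarrow> ends H' e = ends H e"
    using sub by (auto simp: subgraph_def)
  have inV: "set_uprod (ends H e) \<subseteq> verts H'" if "e \<in> edges H'" for e
    using that H' H'ends by (metis signed_graph_def)
  have EG: "E \<subseteq> edges G" using F'F F_sub H'sub rest by (auto simp: E_def)
  have "set_uprod (ends G e) \<subseteq> verts H' - {v}" if "e \<in> E" for e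
  proof (cases "e \<in> F'")
    case True
    moreover have "finite F'" using F'F finite_sets(3) by (rule finite_subset)
    \<comment> \<open>A nonempty \<open>F'\<close> makes the minimum positive, so \<open>H'\<close>
      has edges in both \<open>A\<close> and \<open>B\<close>, which bring in \<open>x\<close> and
      \<open>y\<close> as vertices.\<close>
    ultimately have "card F' \<noteq> 0" by auto
    then have "?A \<noteq> {}" "?B \<noteq> {}" using cF' by auto
    then obtain a b where "a \<in> ?A" "b \<in> ?B" by blast
    then have "x \<in> verts H'" "y \<in> verts H'" using inV[of a] inV[of b] A_ends B_ends by auto
    then show ?thesis using True F'F F_ends v_neq by auto
  next
    case False
    then have "e \<in> edges H'" "e \<in> edges G - F" using that H'sub rest by (auto simp: E_def)
    then show ?thesis using inV[of e] rest_ends[of e] rest_v[of e] by auto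
  qed
  moreover have "finite (verts H')" "finite E"
    using H' EG finite_sets by (auto simp: signed_graph_def intro: finite_subset)
  ultimately have "signed_graph G'" by (auto simp: signed_graph_def G'_def)
  then have subG: "subgraph G' G"
    using EG H'sub verts_H by (auto simp: subgraph_def G'_def)
  have "F \<inter> edges G' = F'" using F'F H'sub rest by (auto simp: G'_def E_def)
  moreover have "edges G' - F = edges H' - (A \<union> B)"
    using F'F H'sub rest by (auto simp: G'_def E_def)
  ultimately have r: "replacement G' H' x y v \<sigma> F' ?A ?B"
    using restrict[OF subG sub] by simp
  have "card ?A = card ?B" using replacement.critical_imp_card_eq[OF r cF' crit] .
  then have "card ?A = card F'" "card ?B = card F'" using cF' by simp_all
  then have "critical k G'" using replacement.critical_iff[OF r] crit by blast
  moreover have "edges G' \<subseteq> (edges H' - (A \<union> B)) \<union> f ` ?A"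
    using A' by (auto simp: G'_def E_def F'_def)
  ultimately show ?thesis using subG by blast
qed

text \<open>Each edge of \<open>F\<close> in \<open>G'\<close> becomes the pair of its images under
  \<open>f\<close> and \<open>g\<close>, so both sides of \<open>v\<close> have the right size at
  once. If there is no such edge, \<open>v\<close> is merely an isolated vertex.\<close>

lemma critical_subgraph_to_H:
  assumes f: "bij_betw f F A" and g: "bij_betw g F B"
    and sub: "subgraph G' G" and crit: "critical k G'"
  shows "\<exists>H'. subgraph H' H \<and> critical k H' \<and>
    edges H' = (edges G' - F) \<union> f ` (F \<inter> edges G') \<union> g ` (F \<inter> edges G')"
proof -
  let ?F = "F \<inter> edges G'"
  define E where "E = (edges G' - F) \<union> f ` ?F \<union> g ` ?F"
  define H' where "H' = H\<lparr>verts := insert v (verts G'), edges := E, negs := negs H \<inter> E\<rparr>"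
  have fA: "f ` ?F \<subseteq> A" and gB: "g ` ?F \<subseteq> B" using f g by (metis bij_betw_imp_surj_on image_mono inf_le1)+
  have G'sub: "verts G' \<subseteq> verts G" "edges G' \<subseteq> edges G" and G': "signed_graph G'"
    and G'ends: "\<And>e. e \<in> edges G' \<Longrightarrow> ends G' e = ends G e"
    using sub by (auto simp: subgraph_def)
  have inV: "set_uprod (ends G e) \<subseteq> verts G'" if "e \<in> edges G'" for e
    using that G' G'ends by (metis signed_graph_def)
  have xy: "x \<in> verts G' \<and> y \<in> verts G'" if "e \<in> ?F" for e
    using inV[of e] F_ends that by auto
  have EH: "E \<subseteq> edges H" using fA gB A_sub B_sub G'sub rest by (auto simp: E_def)
  have "set_uprod (ends H e) \<subseteq> insert v (verts G')" if "e \<in> E" for e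
  proof -
    from that consider "e \<in> edges G' - F" | "e \<in> f ` ?F" | "e \<in> g ` ?F" by (auto simp: E_def)
    then show ?thesis
    proof cases
      case 1
      then have "e \<in> edges G'" "e \<in> edges G - F" using G'sub by auto
      then show ?thesis using inV[of e] rest_ends[of e] by auto
    next
      case 2
      then have "e \<in> A" "x \<in> verts G'" using fA xy by auto
      then show ?thesis using A_ends by auto
    next
      case 3
      then have "e \<in> B" "y \<in> verts G'" using gB xy by auto
      then show ?thesis using B_ends by auto
    qed
  qed
  moreover have "finite (verts G')" "finite E"
    using G' EH finite_sets by (auto simp: signed_graph_def intro: finite_subset)
  ultimately have "signed_graph H'" by (auto simp: signed_graph_def H'_def)
  then have subH: "subgraph H' H"
    using EH G'sub verts_H by (auto simp: subgraph_def H'_def)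
  have RAB: "(edges G' - F) \<inter> (A \<union> B) = {}" using rest G'sub by blast
  have "A \<inter> edges H' = f ` ?F" "B \<inter> edges H' = g ` ?F"
    using fA gB AB RAB by (auto simp: H'_def E_def)
  moreover have "edges G' - F = edges H' - (A \<union> B)"
    using fA gB RAB by (auto simp: H'_def E_def)
  ultimately have rep: "replacement G' H' x y v \<sigma> ?F (f ` ?F) (g ` ?F)"
    using restrict[OF sub subH] by simp
  have "card (f ` ?F) = card ?F" "card (g ` ?F) = card ?F"
    using f g by (metis bij_betw_imp_inj_on card_image inf_le1 inj_on_subset)+
  then have "critical k H'" using replacement.critical_iff[OF rep] crit by blast
  then show ?thesis using subH by (auto simp: H'_def E_def)
qed

lemma decomposable_to_G:
  assumes "decomposable H" shows "decomposable G"
proof -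
  from assms obtain k n ks Hs where c: "critical k H" "n \<ge> (2::nat)" "\<forall>i<n. ks i \<ge> 1"
    "(\<Sum>i<n. ks i) = k" "\<forall>i<n. subgraph (Hs i) H \<and> critical (ks i) (Hs i)"
    "\<forall>i<n. \<forall>j<n. i \<noteq> j \<longrightarrow> edges (Hs i) \<inter> edges (Hs j) = {}"
    by (rule decomposableE)
  \<comment> \<open>One bijection serves all members of the decomposition, which keeps their images
    disjoint.\<close>
  obtain f where f: "bij_betw f A F"
    using finite_same_card_bij[of A F] finite_sets card_A by auto
  have "\<forall>i. \<exists>G'. i < n \<longrightarrow> subgraph G' G \<and> critical (ks i) G' \<and>
      edges G' \<subseteq> (edges (Hs i) - (A \<union> B)) \<union> f ` (A \<inter> edges (Hs i))"
    using critical_subgraph_to_G[OF f] c(5) by blast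
  then obtain Gs where Gs: "\<And>i. i < n \<Longrightarrow> subgraph (Gs i) G \<and> critical (ks i) (Gs i) \<and>
      edges (Gs i) \<subseteq> (edges (Hs i) - (A \<union> B)) \<union> f ` (A \<inter> edges (Hs i))"
    by metis
  have "edges (Gs i) \<inter> edges (Gs j) = {}" if ij: "i < n" "j < n" "i \<noteq> j" for i j
  proof -
    have d: "edges (Hs i) \<inter> edges (Hs j) = {}" using c(6) ij by blast
    then have "f ` (A \<inter> edges (Hs i)) \<inter> f ` (A \<inter> edges (Hs j)) = {}"
      using f by (intro disjoint_images[of f A]) (auto simp: bij_betw_def)
    moreover have "f ` (A \<inter> X) \<subseteq> F" for X
      using f by (metis bij_betw_imp_surj_on image_mono inf_le1)
    \<comment> \<open>Names of \<open>F\<close> can recur in \<open>H\<close> only within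
      \<open>A\<close> and \<open>B\<close>.\<close>
    moreover have "(edges (Hs l) - (A \<union> B)) \<inter> F = {}" if "l < n" for l
      using c(5) that rest unfolding subgraph_def by blast
    moreover have "(edges (Hs i) - (A \<union> B)) \<inter> (edges (Hs j) - (A \<union> B)) = {}" using d by blast
    \<comment> \<open>The third layer is empty, as only \<open>F\<close> receives edges
      here.\<close>
    ultimately have "((edges (Hs i) - (A \<union> B)) \<union> f ` (A \<inter> edges (Hs i)) \<union> {}) \<inter>
        ((edges (Hs j) - (A \<union> B)) \<union> f ` (A \<inter> edges (Hs j)) \<union> {}) = {}"
      using ij by (intro disjoint_layers[of _ _ _ _ _ _ F "{}"]) (simp_all add: Int_Un_distrib2)
    then show ?thesis
      using Int_mono[OF Gs[OF ij(1), THEN conjunct2, THEN conjunct2]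
          Gs[OF ij(2), THEN conjunct2, THEN conjunct2]] by simp
  qed
  moreover have "critical k G" using critical_iff[OF card_A card_B] c(1) by blast
  ultimately show ?thesis using c(2-4) Gs by (intro decomposableI[of k G n ks Gs]) auto
qed

lemma decomposable_to_H:
  assumes "decomposable G" shows "decomposable H"
proof -
  from assms obtain k n ks Gs where c: "critical k G" "n \<ge> (2::nat)" "\<forall>i<n. ks i \<ge> 1"
    "(\<Sum>i<n. ks i) = k" "\<forall>i<n. subgraph (Gs i) G \<and> critical (ks i) (Gs i)"
    "\<forall>i<n. \<forall>j<n. i \<noteq> j \<longrightarrow> edges (Gs i) \<inter> edges (Gs j) = {}"
    by (rule decomposableE)
  obtain f where f: "bij_betw f F A"
    using finite_same_card_bij[of F A] finite_sets card_A by auto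
  obtain g where g: "bij_betw g F B"
    using finite_same_card_bij[of F B] finite_sets card_B by auto
  have "\<forall>i. \<exists>H'. i < n \<longrightarrow> subgraph H' H \<and> critical (ks i) H' \<and>
      edges H' = (edges (Gs i) - F) \<union> f ` (F \<inter> edges (Gs i)) \<union> g ` (F \<inter> edges (Gs i))"
    using critical_subgraph_to_H[OF f g] c(5) by blast
  then obtain Hs where Hs: "\<And>i. i < n \<Longrightarrow> subgraph (Hs i) H \<and> critical (ks i) (Hs i) \<and>
      edges (Hs i) = (edges (Gs i) - F) \<union> f ` (F \<inter> edges (Gs i)) \<union> g ` (F \<inter> edges (Gs i))"
    by metis
  have "edges (Hs i) \<inter> edges (Hs j) = {}" if ij: "i < n" "j < n" "i \<noteq> j" for i j
  proof -
    have d: "edges (Gs i) \<inter> edges (Gs j) = {}" using c(6) ij by blast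
    have "f ` (F \<inter> edges (Gs i)) \<inter> f ` (F \<inter> edges (Gs j)) = {}"
      using f d by (intro disjoint_images[of f F]) (auto simp: bij_betw_def)
    moreover have "g ` (F \<inter> edges (Gs i)) \<inter> g ` (F \<inter> edges (Gs j)) = {}"
      using g d by (intro disjoint_images[of g F]) (auto simp: bij_betw_def)
    moreover have "f ` (F \<inter> X) \<subseteq> A" "g ` (F \<inter> X) \<subseteq> B" for X
      using f g by (metis bij_betw_imp_surj_on image_mono inf_le1)+
    moreover have "(edges (Gs l) - F) \<inter> (A \<union> B) = {}" if "l < n" for l
      using c(5) that rest unfolding subgraph_def by blast
    moreover have "(edges (Gs i) - F) \<inter> (edges (Gs j) - F) = {}" using d by blast
    ultimately show ?thesis
      unfolding Hs[OF ij(1), THEN conjunct2, THEN conjunct2]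
        Hs[OF ij(2), THEN conjunct2, THEN conjunct2]
      using AB ij by (intro disjoint_layers[of _ _ _ _ _ _ A B]) (simp_all add: Int_Un_distrib2)
  qed
  moreover have "critical k H" using critical_iff[OF card_A card_B] c(1) by blast
  ultimately show ?thesis using c(2-4) Hs by (intro decomposableI[of k H n ks Hs]) auto
qed

end

section \<open>Subdivisions\<close>

text \<open>\<open>F\<close> has a sign, so \<open>F \<subseteq> negs G\<close> serves as
  \<open>\<sigma>\<close>.\<close>

lemma multiedge_subdivision_full_replacement:
  assumes G: "signed_graph G" and "multiedge_subdivision G H"
  obtains x y v \<sigma> F A B where "full_replacement G H x y v \<sigma> F A B"
proof -
  from assms(2) obtain x y F v A B where m: "multiedge G x y F" "has_sign G F" "v \<notin> verts G"
    "A \<inter> (edges G - F) = {}" "B \<inter> (edges G - F) = {}" "A \<inter> B = {}"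
    "finite A" "card A = card F" "finite B" "card B = card F"
    "verts H = insert v (verts G)" "edges H = (edges G - F) \<union> A \<union> B"
    "\<forall>e\<in>edges G - F. ends H e = ends G e"
    "\<forall>e\<in>A. ends H e = Upair v x" "\<forall>e\<in>B. ends H e = Upair v y"
    "negs H = (negs G - F) \<union> (if F \<subseteq> negs G then B else {})"
    unfolding multiedge_subdivision_def by blast
  have F: "F \<noteq> {}" "F \<subseteq> edges G" "\<And>e. e \<in> F \<Longrightarrow> ends G e = Upair x y"
    using m(1) by (auto simp: multiedge_def)
  have V: "set_uprod (ends G e) \<subseteq> verts G" if "e \<in> edges G" for e
    using G that by (simp add: signed_graph_def)
  have N: "negs G \<subseteq> edges G" and fin: "finite (verts G)" "finite (edges G)"
    using G by (auto simp: signed_graph_def)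
  \<comment> \<open>Any edge of the nonempty multiedge shows that \<open>x\<close> and
    \<open>y\<close> are old vertices, hence different from \<open>v\<close>.\<close>
  obtain e0 where "e0 \<in> F" using F(1) by blast
  then have xy: "x \<in> verts G" "y \<in> verts G" using V[of e0] F by auto
  have neq: "v \<noteq> x" "v \<noteq> y" using xy m(3) by auto
  have H: "signed_graph H"
    unfolding signed_graph_def
  proof (intro conjI ballI)
    show "finite (verts H)" "finite (edges H)" using fin m by auto
    show "negs H \<subseteq> edges H" using N by (auto simp: m(12,16) split: if_splits)
    fix e assume "e \<in> edges H"
    then consider "e \<in> edges G - F" | "e \<in> A" | "e \<in> B" using m(12) by auto
    then show "set_uprod (ends H e) \<subseteq> verts H"
      using V[of e] m(11,13-15) xy by cases auto
  qed
  have "full_replacement G H x y v (F \<subseteq> negs G) F A B"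
  proof
    show "edges G - F = edges H - (A \<union> B)" using m(4,5,12) by auto
    fix e
    show "e \<in> edges G - F \<Longrightarrow> v \<notin> set_uprod (ends G e)" using V[of e] m(3) by auto
    show "e \<in> edges G - F \<Longrightarrow> e \<in> negs H \<longleftrightarrow> e \<in> negs G" using m(5,16) by auto
    show "e \<in> F \<Longrightarrow> e \<in> negs G \<longleftrightarrow> F \<subseteq> negs G" using m(2) by (auto simp: has_sign_def)
    show "e \<in> A \<Longrightarrow> e \<notin> negs H" using m(4,6,16) N by (auto split: if_splits)
    show "e \<in> B \<Longrightarrow> e \<in> negs H \<longleftrightarrow> F \<subseteq> negs G" using m(5,16) N by (auto split: if_splits)
  qed (use G H F m neq xy in auto)
  then show ?thesis by (rule that)
qed

text \<open>The records may differ in \<open>ends\<close> outside the edges, so they need not be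
  equal; colouring costs depend only on the meaningful values.\<close>

lemma same_sgraph_invariants:
  assumes "signed_graph G" "same_sgraph G H"
  shows "signed_graph H" "frustration_index G = frustration_index H"
    "critical k G \<longleftrightarrow> critical k H" "decomposable G \<longleftrightarrow> decomposable H"
proof -
  have graph: "signed_graph H'" if "signed_graph G'" "same_sgraph G' H'" for G' H' :: "('a, 'b) sgraph"
    using that by (auto simp: same_sgraph_def signed_graph_def)
  \<comment> \<open>Stated for arbitrary graphs so that it also applies after an edge deletion, as
    criticality requires.\<close>
  have fr: "frustration_index G' = frustration_index H'"
    if "signed_graph G'" "same_sgraph G' H'" for G' H' :: "('a, 'b) sgraph"
  proof -
    have "agrees G' s e = agrees H' s e" if "e \<in> edges G'" for s e
      using \<open>same_sgraph G' H'\<close> that by (simp add: agrees_def same_sgraph_def)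
    then have "{e \<in> edges G'. \<not> agrees G' s e} = {e \<in> edges H'. \<not> agrees H' s e}" for s
      using that(2) by (auto simp: same_sgraph_def)
    then have c: "cost G' s = cost H' s" for s by (simp add: cost_def)
    have "frustration_index G' \<le> frustration_index H'"
      using that(1) graph[OF that] by (rule frustration_mono) (auto simp: c)
    moreover have "frustration_index H' \<le> frustration_index G'"
      using graph[OF that] that(1) by (rule frustration_mono) (auto simp: c)
    ultimately show ?thesis by (rule antisym)
  qed
  have del: "same_sgraph (delete_edges G P) (delete_edges H P)" for P
    using assms(2) by (auto simp: same_sgraph_def)
  have eq: "edges H = edges G" using assms(2) by (simp add: same_sgraph_def)
  show "signed_graph H" "frustration_index G = frustration_index H" using graph fr assms by auto
  have crit: "critical k G \<longleftrightarrow> critical k H" for k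
    unfolding critical_def eq fr[OF assms] fr[OF signed_graph_delete[OF assms(1)] del] ..
  then show "critical k G \<longleftrightarrow> critical k H" .
  have "subgraph K G \<longleftrightarrow> subgraph K H" for K
    using assms(2) by (auto simp: same_sgraph_def subgraph_def)
  then show "decomposable G \<longleftrightarrow> decomposable H"
    unfolding decomposable_def crit by simp
qed

text \<open>\<open>signed_graph H\<close> is carried through the induction because each further step
  starts from an intermediate graph.\<close>

lemma subdivision_invariants:
  assumes "subdivision G H" "signed_graph G"
  shows "signed_graph H \<and> frustration_index G = frustration_index H \<and>
    (critical k G \<longleftrightarrow> critical k H) \<and> (decomposable G \<longleftrightarrow> decomposable H)"
  using assms
proof (induction rule: subdivision.induct)
  case (same H)
  then show ?case using same_sgraph_invariants by blast
next
  case (step H K)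
  then obtain x y v \<sigma> F A B where "full_replacement H K x y v \<sigma> F A B"
    using multiedge_subdivision_full_replacement by blast
  then interpret full_replacement H K x y v \<sigma> F A B .
  have "frustration_index H = frustration_index K"
    using card_A card_B by (intro frustration_eq) simp
  then show ?case
    using step graph_H critical_iff[OF card_A card_B] decomposable_to_G decomposable_to_H by auto
qed

theorem theorem3p2:
  fixes G H :: "('v, 'e) sgraph" and k :: nat
  assumes "k \<ge> 1"
    and "signed_graph G" and "signed_graph H"
    and "subdivision G H"
  shows "frustration_index G = frustration_index H
    \<and> (critical k G \<longleftrightarrow> critical k H)
    \<and> (decomposable G \<longleftrightarrow> decomposable H)"
  using subdivision_invariants[OF assms(4,2)] by blast

end
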